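(* Let $c\in\mathbb{R}^n$ and $f(x)=\langle c,x\rangle$. Let $\mathcal{L}:\mathbb{R}^n\times C\to\mathbb{R}$ be the Lagrangian defined by $$\mathcal{L}(q,\dot q)=\langle\Pi_{\mathcal{A}_0}c,q\rangle-h(\Pi_{\mathcal{A}}\dot q).$$ For any solution $\gamma(t)=(q(t),\dot q(t))$ of the Lagrangian dynamical system $$\frac{d}{dt}\frac{\partial\mathcal{L}}{\partial\dot q_i}=\frac{\partial\mathcal{L}}{\partial q_i},\qquad\frac{d}{dt}q_i=\dot q_i,\qquad i=1,\dots,n,$$ with this Lagrangian, the projection $x(t)=\Pi_{\mathcal{A}}\dot q(t)$ is the solution of $(H\text{-}SD)$ with initial condition $x^0=\Pi_{\mathcal{A}}\dot q(0)$.
   Context: Let $m<n$ be positive integers, $A\in\mathbb{R}^{m\times n}$ of full rank, $b\in\operatorname{Im}A$, $\mathcal{A}=\{x\in\mathbb{R}^n: Ax=b\}$, $\mathcal{A}_0=\ker A$. Let $C\subset\mathbb{R}^n$ be nonempty, open and convex, with $\mathcal{F}=C\cap\mathcal{A}\neq\emptyset$. $\Pi_{\mathcal{A}_0}$ is the Euclidean orthogonal projection onto $\mathcal{A}_0$, and $\Pi_{\mathcal{A}}$ is the orthogonal projection onto $\mathcal{A}$, i.e. $\Pi_{\mathcal{A}}x=\widetilde x+\Pi_{\mathcal{A}_0}(x-\widetilde x)$ for any $\widetilde x\in\mathcal{A}$. $\Gamma_0(\mathbb{R}^n)$ is the set of lower semicontinuous proper convex functions $\mathbb{R}^n\to\mathbb{R}\cup\{+\infty\}$.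 A function $h\in\Gamma_0(\mathbb{R}^n)$ is of Legendre type if it is differentiable on $\operatorname{int}\operatorname{dom}h$, $|\nabla h(x^j)|\to+\infty$ for every sequence $(x^j)\subset\operatorname{int}\operatorname{dom}h$ converging to a boundary point of $\operatorname{dom}h$, and $h$ is strictly convex on $\operatorname{int}\operatorname{dom}h$. The function $h\in\Gamma_0(\mathbb{R}^n)$ is assumed to satisfy: (i) $h$ is of Legendre type with $\operatorname{int}\operatorname{dom}h=C$; (ii) $h_{|C}\in\mathcal{C}^2(C;\mathbb{R})$ and $\nabla^2h(x)$ is symmetric positive definite for all $x\in C$; (iii) $x\mapsto\nabla^2h(x)$ is locally Lipschitz continuous on $C$. Set $H=\nabla^2h$ on $C$. $\nabla_Hf_{|\mathcal{F}}(x)=H(x)^{-1}[I-A^T(AH(x)^{-1}A^T)^{-1}AH(x)^{-1}]\nabla f(x)$, $x\in\mathcal{F}$, is the gradient of $f_{|\mathcal{F}}$ for the Riemannian metric $(u,v)^H_x=\langle H(x)u,v\rangle$ on $\mathcal{F}$ (tangent space $\mathcal{A}_0$). $(H\text{-}SD)$ denotes the dynamical system $\dot x(t)+\nabla_Hf_{|\mathcal{F}}(x(t))=0$, $x(0)=x^0\in\mathcal{F}$. Given a real-valued Lagrangian $\mathcal{L}(q,\dot q)$, with $q=(q_1,\dots,q_n)$ and $\dot q=(\dot q_1,\dots,\dot q_n)$, the solutions of the associated Lagrange equations are the piecewise $C^1$ paths $\gamma:t\mapsto(q(t),\dot q(t))$, defined for $t\in J\subset\mathbb{R}$, that satisfy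 these equations; they appear as extremals of the functional $\widehat{\mathcal{L}}(\gamma)=\int_J\mathcal{L}(q(t),\dot q(t))\,dt$. *)

theory Defs
  imports "HOL-Analysis.Analysis"
begin

section \<open>Gradients and Hessians\<close>

definition grad :: "(real^'n \<Rightarrow> real) \<Rightarrow> real^'n \<Rightarrow> real^'n" where
  "grad f x = (THE D. GDERIV f x :> D)"

definition hessian :: "(real^'n \<Rightarrow> real) \<Rightarrow> real^'n \<Rightarrow> real^'n^'n" where
  "hessian f x = jacobian (grad f) (at x)"

definition C2_on :: "(real^'n) set \<Rightarrow> (real^'n \<Rightarrow> real) \<Rightarrow> bool" where
  "C2_on C f \<longleftrightarrow>
     (\<forall>x\<in>C. f differentiable (at x)) \<and>
     (\<forall>x\<in>C. grad f differentiable (at x)) \<and>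
     continuous_on C (hessian f)"

definition sym_pos_def :: "real^'n^'n \<Rightarrow> bool" where
  "sym_pos_def M \<longleftrightarrow> transpose M = M \<and> (\<forall>v. v \<noteq> 0 \<longrightarrow> (M *v v) \<bullet> v > 0)"

definition locally_lipschitz_on :: "'a::metric_space set \<Rightarrow> ('a \<Rightarrow> 'b::metric_space) \<Rightarrow> bool" where
  "locally_lipschitz_on S F \<longleftrightarrow> (\<forall>x\<in>S. \<exists>e>0. \<exists>L. L-lipschitz_on (ball x e \<inter> S) F)"

section \<open>Extended-valued convex functions\<close>

definition edom :: "('a \<Rightarrow> ereal) \<Rightarrow> 'a set" where
  "edom h = {x. h x < \<infinity>}"

text \<open>The real-valued part of an extended-valued function, meaningful only where
  the function is finite.\<close>

definition rpart :: "('a \<Rightarrow> ereal) \<Rightarrow> 'a \<Rightarrow> real" where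
  "rpart h x = real_of_ereal (h x)"

text \<open>The class \<open>\<Gamma>\<^sub>0\<close>. Since \<open>-\<infinity>\<close> is excluded and \<open>0 * \<infinity> = 0\<close> on \<^typ>\<open>ereal\<close>,
  the convexity inequality makes sense for all weights, including \<open>0\<close> and \<open>1\<close>.\<close>

definition Gamma0 :: "('a::real_normed_vector \<Rightarrow> ereal) set" where
  "Gamma0 = {h.
     (\<forall>x. h x \<noteq> -\<infinity>) \<and> (\<exists>x. h x \<noteq> \<infinity>) \<and>
     (\<forall>x. h x \<le> Liminf (at x) h) \<and>
     (\<forall>x y u v. 0 \<le> u \<longrightarrow> 0 \<le> v \<longrightarrow> u + v = 1 \<longrightarrow>
        h (u *\<^sub>R x + v *\<^sub>R y) \<le> ereal u * h x + ereal v * h y)}"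

definition legendre_type :: "(real^'n \<Rightarrow> ereal) \<Rightarrow> bool" where
  "legendre_type h \<longleftrightarrow>
     (\<forall>x\<in>interior (edom h). rpart h differentiable (at x)) \<and>
     (\<forall>xs l. (\<forall>j::nat. xs j \<in> interior (edom h)) \<longrightarrow> xs \<longlonglongrightarrow> l \<longrightarrow> l \<in> frontier (edom h) \<longrightarrow>
        filterlim (\<lambda>j. norm (grad (rpart h) (xs j))) at_top sequentially) \<and>
     (\<forall>x\<in>interior (edom h). \<forall>y\<in>interior (edom h). \<forall>u. x \<noteq> y \<longrightarrow> 0 < u \<longrightarrow> u < 1 \<longrightarrow>
        rpart h (u *\<^sub>R x + (1 - u) *\<^sub>R y) < u * rpart h x + (1 - u) * rpart h y)"

section \<open>The affine constraint and the system (H-SD)\<close>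

definition aff :: "real^'n^'m \<Rightarrow> real^'m \<Rightarrow> (real^'n) set" where
  "aff A b = {x. A *v x = b}"

text \<open>The sets \<^term>\<open>aff A b\<close> are closed and, when nonempty, affine, so \<^const>\<open>closest_point\<close>
  is the orthogonal projection onto them; \<^term>\<open>aff A 0\<close> is the kernel of \<open>A\<close>.\<close>

abbreviation proj :: "real^'n^'m \<Rightarrow> real^'m \<Rightarrow> real^'n \<Rightarrow> real^'n" where
  "proj A b \<equiv> closest_point (aff A b)"

lemma subspace_kernel: "subspace (aff A 0)"
  by (auto simp: aff_def subspace_def matrix_vector_right_distrib matrix_vector_mult_scaleR)

lemma proj_kernel_orthogonal:
  assumes "A *v u = 0"
  shows "(x - proj A 0 x) \<bullet> u = 0"
proof -
  have conv: "convex (aff A 0)" and cl: "closed (aff A 0)" and ne: "aff A 0 \<noteq> {}"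
    using subspace_kernel[of A] by (auto intro: subspace_imp_convex closed_subspace dest: subspace_0)
  have "proj A 0 x \<in> aff A 0" by (rule closest_point_in_set[OF cl ne])
  moreover have "u \<in> aff A 0" using assms by (simp add: aff_def)
  ultimately have "proj A 0 x + u \<in> aff A 0" "proj A 0 x - u \<in> aff A 0"
    using subspace_kernel[of A] by (auto intro: subspace_add subspace_diff)
  from closest_point_dot[OF conv cl this(1), of x] closest_point_dot[OF conv cl this(2), of x]
  show ?thesis by simp
qed

lemma proj_affine:
  assumes "A *v y = b"
  shows "proj A b x = y + proj A 0 (x - y)"
proof -
  have conv: "convex (aff A 0)" and cl: "closed (aff A 0)" and ne: "aff A 0 \<noteq> {}"
    using subspace_kernel[of A] by (auto intro: subspace_imp_convex closed_subspace dest: subspace_0)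
  have eq: "aff A b = (\<lambda>z. y + z) ` aff A 0"
  proof (intro equalityI subsetI)
    fix z assume "z \<in> aff A b"
    then have "z = y + (z - y)" "z - y \<in> aff A 0"
      using assms by (auto simp: aff_def matrix_vector_mult_diff_distrib)
    then show "z \<in> (\<lambda>z. y + z) ` aff A 0" by blast
  qed (use assms in \<open>auto simp: aff_def matrix_vector_right_distrib\<close>)
  have "y + proj A 0 (x - y) = proj A b x"
  proof (rule closest_point_unique)
    show "convex (aff A b)" "closed (aff A b)"
      unfolding eq using conv cl by (auto intro: convex_translation closed_translation)
    show "y + proj A 0 (x - y) \<in> aff A b"
      unfolding eq using closest_point_in_set[OF cl ne] by blast
    show "\<forall>z\<in>aff A b. dist x (y + proj A 0 (x - y)) \<le> dist x z"
      unfolding eq using closest_point_le[OF cl, of _ "x - y"]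
      by (auto simp: dist_norm algebra_simps)
  qed
  then show ?thesis by simp
qed

definition riem_grad ::
  "real^'n^'m \<Rightarrow> (real^'n \<Rightarrow> real^'n^'n) \<Rightarrow> (real^'n \<Rightarrow> real) \<Rightarrow> real^'n \<Rightarrow> real^'n" where
  "riem_grad A H f x =
     (let Hi = matrix_inv (H x) in
      (Hi ** (mat 1 - transpose A ** matrix_inv (A ** Hi ** transpose A) ** A ** Hi))
        *v grad f x)"

text \<open>A solution of (H-SD) on the time interval \<open>J\<close>. The derivative is one-sided at
  endpoints belonging to \<open>J\<close>.\<close>

definition HSD_solution ::
  "real^'n^'m \<Rightarrow> real^'m \<Rightarrow> (real^'n) set \<Rightarrow> (real^'n \<Rightarrow> real^'n^'n) \<Rightarrow> (real^'n \<Rightarrow> real) \<Rightarrow>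
   real set \<Rightarrow> real^'n \<Rightarrow> (real \<Rightarrow> real^'n) \<Rightarrow> bool" where
  "HSD_solution A b C H f J x0 x \<longleftrightarrow>
     x0 \<in> C \<inter> aff A b \<and> x 0 = x0 \<and>
     (\<forall>t\<in>J. x t \<in> C \<inter> aff A b \<and>
        (x has_vector_derivative - riem_grad A H f (x t)) (at t within J))"

section \<open>Lagrange equations\<close>

text \<open>A Lagrangian is taken with values in \<^typ>\<open>ereal\<close>, because the one under study contains
  the extended-valued function \<open>h\<close>. The Lagrange equations are about real-valued Lagrangians
  and their partial derivatives, so they are considered only at points around which the
  Lagrangian is finite and at which it is differentiable.\<close>

definition regular_point :: "(real^'n \<Rightarrow> real^'n \<Rightarrow> ereal) \<Rightarrow> real^'n \<Rightarrow> real^'n \<Rightarrow> bool" where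
  "regular_point L q v \<longleftrightarrow>
     (\<forall>\<^sub>F z in nhds (q, v). \<bar>L (fst z) (snd z)\<bar> \<noteq> \<infinity>) \<and>
     (\<lambda>z. real_of_ereal (L (fst z) (snd z))) differentiable (at (q, v))"

definition partial_q :: "(real^'n \<Rightarrow> real^'n \<Rightarrow> ereal) \<Rightarrow> 'n \<Rightarrow> real^'n \<Rightarrow> real^'n \<Rightarrow> real" where
  "partial_q L i q v = deriv (\<lambda>s. real_of_ereal (L (q + s *\<^sub>R axis i 1) v)) 0"

definition partial_v :: "(real^'n \<Rightarrow> real^'n \<Rightarrow> ereal) \<Rightarrow> 'n \<Rightarrow> real^'n \<Rightarrow> real^'n \<Rightarrow> real" where
  "partial_v L i q v = deriv (\<lambda>s. real_of_ereal (L q (v + s *\<^sub>R axis i 1))) 0"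

text \<open>Solutions \<open>t \<mapsto> (q t, v t)\<close>, with \<open>v\<close> standing for the velocity, of the Lagrange equations
  of a Lagrangian on \<^term>\<open>UNIV \<times> C\<close>. The paths are continuous and piecewise \<open>C\<^sup>1\<close>, so the
  equations are imposed outside a set of exceptional times that is finite in every compact
  subinterval of \<open>J\<close>; this set may also absorb the endpoints of \<open>J\<close>.\<close>

definition lagrange_solution ::
  "(real^'n \<Rightarrow> real^'n \<Rightarrow> ereal) \<Rightarrow> (real^'n) set \<Rightarrow> real set \<Rightarrow>
   (real \<Rightarrow> real^'n) \<Rightarrow> (real \<Rightarrow> real^'n) \<Rightarrow> bool" where
  "lagrange_solution L C J q v \<longleftrightarrow>
     (\<forall>t\<in>J. v t \<in> C \<and> regular_point L (q t) (v t)) \<and>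
     (\<forall>a b. {a..b} \<subseteq> J \<longrightarrow>
        (\<lambda>t. (q t, v t)) piecewise_C1_differentiable_on {a..b} \<and>
        (\<exists>S. finite S \<and> (\<forall>t\<in>{a..b} - S. \<forall>i.
           ((\<lambda>s. partial_v L i (q s) (v s)) has_real_derivative partial_q L i (q t) (v t))
             (at t within J) \<and>
           ((\<lambda>s. q s $ i) has_real_derivative v t $ i) (at t within J))))"

definition lagrangian ::
  "real^'n^'m \<Rightarrow> real^'m \<Rightarrow> (real^'n \<Rightarrow> ereal) \<Rightarrow> real^'n \<Rightarrow> real^'n \<Rightarrow> real^'n \<Rightarrow> ereal" where
  "lagrangian A b h c q v = ereal (proj A 0 c \<bullet> q) - h (proj A b v)"

end

theory Submission
  imports Defs
begin

text \<open>Let \<open>g\<close> be the finite part of \<open>h\<close>, \<open>P\<close> the projection onto \<open>ker A\<close> and \<open>x = proj A b v\<close>.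
  The Lagrange equations say that the Legendre coordinate \<open>P (grad g x)\<close> moves with constant
  velocity \<open>-P c\<close>. Differentiating, the velocity \<open>w\<close> of \<open>x\<close> lies in \<open>ker A\<close> and
  \<open>hessian g x *v w + c\<close> is orthogonal to \<open>ker A\<close>, which forces \<open>w = - riem_grad\<close>. This may fail
  at finitely many times per compact interval, but \<open>riem_grad\<close> is continuous along \<open>x\<close>, so the
  fundamental theorem of calculus recovers the derivative there. Conversely, the Legendre
  coordinate of every solution of (H-SD) moves with velocity \<open>-P c\<close>, and the coordinate is
  injective, which gives uniqueness.\<close>

section \<open>Orthogonal projection onto the kernel and onto the affine set\<close>

lemma proj_kernel_in_kernel: "A *v proj A 0 x = 0"
proof -
  have "proj A 0 x \<in> aff A 0"
    using subspace_kernel[of A]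
    by (intro closest_point_in_set) (auto intro: closed_subspace dest: subspace_0)
  then show ?thesis by (simp add: aff_def)
qed

text \<open>Both candidates differ from \<open>x\<close> by a vector orthogonal to the kernel, so
  their difference is a kernel vector orthogonal to itself. This replaces distance minimization by
  algebra in the computations below.\<close>

lemma proj_kernel_unique:
  assumes "A *v p = 0" "\<And>u. A *v u = 0 \<Longrightarrow> (x - p) \<bullet> u = 0"
  shows "proj A 0 x = p"
proof -
  let ?d = "proj A 0 x - p"
  have d: "A *v ?d = 0"
    by (simp add: matrix_vector_mult_diff_distrib assms(1) proj_kernel_in_kernel)
  have "?d \<bullet> ?d = (x - p) \<bullet> ?d - (x - proj A 0 x) \<bullet> ?d"
    by (simp add: inner_diff_left)
  also have "\<dots> = 0" using assms(2)[OF d] proj_kernel_orthogonal[OF d] by simp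
  finally show ?thesis by simp
qed

lemma proj_kernel_fixes: "A *v u = 0 \<Longrightarrow> proj A 0 u = u"
  by (rule proj_kernel_unique) auto

text \<open>Both sides equal \<open>proj A 0 x \<bullet> proj A 0 y\<close>, since each residual is
  orthogonal to the kernel.\<close>

lemma proj_kernel_inner:
  fixes A :: "real^'n^'m"
  shows "proj A 0 x \<bullet> y = x \<bullet> proj A 0 y"
  using proj_kernel_orthogonal[of A "proj A 0 y" x, OF proj_kernel_in_kernel]
    proj_kernel_orthogonal[of A "proj A 0 x" y, OF proj_kernel_in_kernel]
  by (simp add: inner_diff_left inner_diff_right inner_commute)

lemma linear_proj_kernel: "linear (proj A 0)"
proof (rule linearI)
  show "proj A 0 (x + y) = proj A 0 x + proj A 0 y" for x y
  proof (rule proj_kernel_unique)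
    fix u assume "A *v u = 0"
    then show "(x + y - (proj A 0 x + proj A 0 y)) \<bullet> u = 0"
      using proj_kernel_orthogonal[of A u x] proj_kernel_orthogonal[of A u y]
      by (simp add: inner_diff_left inner_add_left)
  qed (simp add: matrix_vector_right_distrib proj_kernel_in_kernel)
  show "proj A 0 (r *\<^sub>R x) = r *\<^sub>R proj A 0 x" for r x
  proof (rule proj_kernel_unique)
    fix u assume "A *v u = 0"
    then show "(r *\<^sub>R x - r *\<^sub>R proj A 0 x) \<bullet> u = 0"
      using proj_kernel_orthogonal[of A u x]
      by (simp add: inner_diff_left)
  qed (simp add: matrix_vector_mult_scaleR proj_kernel_in_kernel)
qed

lemma bounded_linear_proj_kernel: "bounded_linear (proj A 0)"
  using linear_proj_kernel by (simp add: linear_conv_bounded_linear)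

lemma proj_add:
  assumes "b \<in> range ((*v) A)"
  shows "proj A b (v + w) = proj A b v + proj A 0 w"
proof -
  from assms obtain y where y: "A *v y = b" by auto
  show ?thesis
    using linear_add[OF linear_proj_kernel, of A "v - y" w]
    by (simp add: proj_affine[OF y] algebra_simps)
qed

lemma proj_in_aff:
  assumes "b \<in> range ((*v) A)"
  shows "proj A b v \<in> aff A b"
proof -
  from assms obtain y where y: "A *v y = b" by auto
  show ?thesis
    using proj_kernel_in_kernel[of A "v - y"]
    unfolding proj_affine[OF y] by (simp add: aff_def matrix_vector_right_distrib y)
qed

lemma continuous_on_proj:
  assumes "b \<in> range ((*v) A)" and "continuous_on S v"
  shows "continuous_on S (\<lambda>t. proj A b (v t))"
proof -
  from assms(1) obtain y where y: "A *v y = b" by auto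
  show ?thesis
    unfolding proj_affine[OF y]
    by (intro continuous_on_add continuous_on_const continuous_on_diff assms(2)
        bounded_linear.continuous_on[OF bounded_linear_proj_kernel])
qed

lemma has_vector_derivative_proj:
  assumes "b \<in> range ((*v) A)" and "(v has_vector_derivative d) F"
  shows "((\<lambda>t. proj A b (v t)) has_vector_derivative proj A 0 d) F"
proof -
  from assms(1) obtain y where y: "A *v y = b" by auto
  have "((\<lambda>t. v t - y) has_vector_derivative d) F"
    using has_vector_derivative_diff[OF assms(2) has_vector_derivative_const] by simp
  then have "((\<lambda>t. proj A 0 (v t - y)) has_vector_derivative proj A 0 d) F"
    by (rule bounded_linear.has_vector_derivative[OF bounded_linear_proj_kernel])
  from has_vector_derivative_add[OF has_vector_derivative_const this, of y]
  show ?thesis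
    unfolding proj_affine[OF y] by simp
qed

section \<open>The Riemannian gradient: characterization and continuity\<close>

lemma invertible_iff_kernel:
  fixes M :: "real^'n^'n"
  shows "invertible M \<longleftrightarrow> (\<forall>x. M *v x = 0 \<longrightarrow> x = 0)"
  unfolding invertible_left_inverse matrix_left_invertible_ker ..

lemma matrix_inv_mult_vector:
  fixes M :: "real^'n^'n"
  assumes "invertible M"
  shows "M *v (matrix_inv M *v x) = x" "matrix_inv M *v (M *v x) = x"
proof -
  have "M ** matrix_inv M = mat 1 \<and> matrix_inv M ** M = mat 1"
    using assms unfolding matrix_inv_def invertible_def by (rule someI_ex)
  then show "M *v (matrix_inv M *v x) = x" "matrix_inv M *v (M *v x) = x"
    by (simp_all add: matrix_vector_mul_assoc)
qed

lemma sym_pos_def_invertible: "sym_pos_def M \<Longrightarrow> invertible M"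
  unfolding invertible_iff_kernel sym_pos_def_def
  by (metis inner_zero_left less_irrefl)

lemma sym_pos_def_inner_pos: "sym_pos_def M \<Longrightarrow> v \<noteq> 0 \<Longrightarrow> 0 < (M *v v) \<bullet> v"
  by (simp add: sym_pos_def_def)

lemma matrix_vector_inner_transpose:
  fixes A :: "real^'n^'m"
  shows "(transpose A *v y) \<bullet> u = y \<bullet> (A *v u)"
  by (metis dot_lmul_matrix transpose_matrix_vector)

lemma transpose_mult_eq_0:
  fixes A :: "real^'n^'m"
  assumes "rank A = CARD('m)" "transpose A *v y = 0"
  shows "y = 0"
proof -
  have "inj ((*v) (transpose A))"
    using assms(1) by (simp add: full_rank_injective[symmetric] rank_transpose)
  then show ?thesis using assms(2) by (metis injD matrix_vector_mult_0_right)
qed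

text \<open>If \<open>y\<close> is annihilated, the quadratic form of \<open>M\<close> vanishes at
  \<open>matrix_inv M *v (transpose A *v y)\<close>. Positive definiteness then gives
  \<open>transpose A *v y = 0\<close>, and full row rank gives \<open>y = 0\<close>.\<close>

lemma invertible_gram:
  fixes A :: "real^'n^'m"
  assumes "rank A = CARD('m)" "sym_pos_def M"
  shows "invertible (A ** matrix_inv M ** transpose A)"
  unfolding invertible_iff_kernel
proof (intro allI impI)
  fix y assume y: "(A ** matrix_inv M ** transpose A) *v y = 0"
  let ?z = "transpose A *v y"
  let ?w = "matrix_inv M *v ?z"
  have Mw: "M *v ?w = ?z"
    by (rule matrix_inv_mult_vector[OF sym_pos_def_invertible[OF assms(2)]])
  have "(M *v ?w) \<bullet> ?w = y \<bullet> (A *v ?w)"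
    unfolding Mw by (rule matrix_vector_inner_transpose)
  also have "\<dots> = 0"
    using y by (simp add: matrix_vector_mul_assoc[symmetric])
  finally have "?w = 0"
    using sym_pos_def_inner_pos[OF assms(2)] by force
  with Mw have "?z = 0" by simp
  then show "y = 0" by (rule transpose_mult_eq_0[OF assms(1)])
qed

text \<open>The two conditions that define the gradient for the metric \<open>H x\<close> on the
  tangent space \<open>ker A\<close>. In the explicit formula, \<open>z\<close> is the Lagrange
  multiplier: it is chosen to bring the result into the kernel, and \<open>transpose A *v z\<close>
  is invisible to kernel vectors.\<close>

lemma riem_grad_properties:
  fixes A :: "real^'n^'m"
  assumes "rank A = CARD('m)" "sym_pos_def (H x)"
  shows riem_grad_in_kernel: "A *v riem_grad A H f x = 0"
    and riem_grad_orthogonal: "A *v u = 0 \<Longrightarrow> (H x *v riem_grad A H f x - grad f x) \<bullet> u = 0"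
proof -
  define Hi where "Hi = matrix_inv (H x)"
  define G where "G = A ** Hi ** transpose A"
  define z where "z = matrix_inv G *v (A *v (Hi *v grad f x))"
  have rg: "riem_grad A H f x = Hi *v (grad f x - transpose A *v z)"
    by (simp add: riem_grad_def Let_def Hi_def G_def z_def matrix_vector_mul_assoc[symmetric]
        matrix_vector_mult_diff_rdistrib)
  have "G *v z = A *v (Hi *v grad f x)"
    unfolding z_def G_def Hi_def
    by (rule matrix_inv_mult_vector[OF invertible_gram[OF assms]])
  then have "A *v (Hi *v (transpose A *v z)) = A *v (Hi *v grad f x)"
    by (simp add: G_def matrix_vector_mul_assoc[symmetric])
  then show "A *v riem_grad A H f x = 0"
    by (simp add: rg matrix_vector_mult_diff_distrib)
  have "H x *v riem_grad A H f x = grad f x - transpose A *v z"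
    unfolding rg Hi_def
    by (rule matrix_inv_mult_vector[OF sym_pos_def_invertible[OF assms(2)]])
  then show "(H x *v riem_grad A H f x - grad f x) \<bullet> u = 0" if "A *v u = 0"
    using that by (simp add: dot_lmul_matrix)
qed

text \<open>The difference of two candidates lies in the kernel, while its image under
  \<open>H x\<close> is orthogonal to the kernel. Its quadratic form is therefore zero.\<close>

lemma riem_grad_unique:
  fixes A :: "real^'n^'m"
  assumes "rank A = CARD('m)" "sym_pos_def (H x)" "A *v w = 0"
    and "\<And>u. A *v u = 0 \<Longrightarrow> (H x *v w - grad f x) \<bullet> u = 0"
  shows "w = riem_grad A H f x"
proof (rule ccontr)
  let ?r = "riem_grad A H f x"
  assume "w \<noteq> ?r"
  then have "0 < (H x *v (w - ?r)) \<bullet> (w - ?r)"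
    by (intro sym_pos_def_inner_pos[OF assms(2)]) simp
  moreover have ker: "A *v (w - ?r) = 0"
    by (simp add: matrix_vector_mult_diff_distrib assms(3)
        riem_grad_in_kernel[where H = H and x = x, OF assms(1,2)])
  have "(H x *v (w - ?r)) \<bullet> (w - ?r) = 0"
    using assms(4)[OF ker] riem_grad_orthogonal[where H = H and x = x and f = f, OF assms(1,2) ker]
    by (simp add: matrix_vector_mult_diff_distrib inner_diff_left)
  ultimately show False by simp
qed

text \<open>Cramer's rule writes \<open>r\<close> as a quotient of determinants, which are
  polynomials in the continuous entries.\<close>

lemma continuous_on_linear_system:
  fixes M :: "'a::topological_space \<Rightarrow> real^'n^'n"
  assumes "continuous_on S M" "continuous_on S p"
    and inv: "\<And>x. x \<in> S \<Longrightarrow> invertible (M x)"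
    and eq: "\<And>x. x \<in> S \<Longrightarrow> M x *v r x = p x"
  shows "continuous_on S r"
proof -
  have d: "det (M x) \<noteq> 0" if "x \<in> S" for x
    using inv[OF that] invertible_det_nz by blast
  have "continuous_on S
    (\<lambda>x. \<chi> k. det (\<chi> i j. if j = k then p x $ i else M x $ i $ j) / det (M x))"
  proof (intro continuous_on_vec_lambda continuous_on_divide)
    fix k
    have *: "continuous_on S (\<lambda>x. if j = k then p x $ i else M x $ i $ j)" for i j
      using assms(1,2) by (cases "j = k") (auto intro!: continuous_intros)
    show "continuous_on S (\<lambda>x. det (\<chi> i j. if j = k then p x $ i else M x $ i $ j))"
      unfolding det_def by (intro continuous_intros) (simp add: *)
    show "continuous_on S (\<lambda>x. det (M x))"
      unfolding det_def using assms(1) by (intro continuous_intros)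
  qed (use d in auto)
  then show ?thesis
    using cramer[OF d] eq by (subst continuous_on_cong[OF refl]) auto
qed

text \<open>The formula with nested inverses is bypassed: the gradient solves a single nonsingular
  linear system whose coefficients depend continuously on the point.\<close>

lemma continuous_on_riem_grad:
  fixes A :: "real^'n^'m"
  assumes "rank A = CARD('m)" and "\<And>x. x \<in> S \<Longrightarrow> sym_pos_def (H x)"
    and "continuous_on S H" "continuous_on S (grad f)"
  shows "continuous_on S (riem_grad A H f)"
proof -
  define Q where "Q = matrix (proj A 0)"
  have Q: "Q *v x = proj A 0 x" for x
    unfolding Q_def by (simp add: matrix_works linear_proj_kernel)
  \<comment> \<open>On the kernel of \<open>A\<close> this matrix acts as the compression of \<open>H x\<close>, on the orthogonal
     complement as the identity.\<close>
  define M where "M x = Q ** H x ** Q + (mat 1 - Q)" for x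
  have M: "M x *v u = proj A 0 (H x *v proj A 0 u) + (u - proj A 0 u)" for x u
    by (simp add: M_def matrix_vector_mult_add_rdistrib matrix_vector_mult_diff_rdistrib
        matrix_vector_mul_assoc[symmetric] Q)
  show ?thesis
  proof (rule continuous_on_linear_system)
    show "continuous_on S M"
      unfolding M_def matrix_matrix_mult_def using assms(3) by (intro continuous_intros)
    show "continuous_on S (\<lambda>x. proj A 0 (grad f x))"
      using assms(4) by (rule bounded_linear.continuous_on[OF bounded_linear_proj_kernel])
    fix x assume "x \<in> S"
    then have H: "sym_pos_def (H x)" by (rule assms(2))
    show "invertible (M x)"
      unfolding invertible_iff_kernel
    proof (intro allI impI)
      fix u assume u: "M x *v u = 0"
      let ?p = "proj A 0 u"
      \<comment> \<open>Testing against \<open>?p\<close> discards \<open>u - ?p\<close> and leaves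
        the quadratic form of \<open>H x\<close>. Once \<open>?p = 0\<close>, the value
        \<open>M x *v u\<close> is \<open>u\<close> itself.\<close>
      have "(H x *v ?p) \<bullet> ?p = (M x *v u) \<bullet> ?p"
        using proj_kernel_orthogonal[of A ?p u, OF proj_kernel_in_kernel]
        by (simp add: M inner_add_left proj_kernel_inner proj_kernel_fixes proj_kernel_in_kernel)
      with u have "?p = 0" using sym_pos_def_inner_pos[OF H] by force
      with u show "u = 0" by (simp add: M linear_0[OF linear_proj_kernel])
    qed
    let ?r = "riem_grad A H f x"
    have "proj A 0 (H x *v ?r - grad f x) = 0"
      by (rule proj_kernel_unique) (use riem_grad_orthogonal[where H = H and x = x, OF assms(1) H] in auto)
    then show "M x *v ?r = proj A 0 (grad f x)"
      by (simp add: M proj_kernel_fixes riem_grad_in_kernel[where H = H and x = x, OF assms(1) H]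
          linear_diff[OF linear_proj_kernel])
  qed
qed


section \<open>Gradients, Hessians and uniqueness for (H-SD)\<close>

lemma GDERIV_grad:
  fixes g :: "real^'n \<Rightarrow> real"
  assumes "g differentiable (at x)"
  shows "GDERIV g x :> grad g x"
proof -
  from assms obtain g' where g': "(g has_derivative g') (at x)"
    by (auto simp: differentiable_def)
  then have "linear g'" by (rule has_derivative_linear)
  \<comment> \<open>The Riesz representative of the functional \<open>g'\<close> is its adjoint
    applied to 1. It serves as the witness for the definite description in
    \<open>grad\<close>.\<close>
  then have "g' = (\<lambda>u. u \<bullet> adjoint g' 1)"
    using adjoint_works[of g'] by (auto simp: fun_eq_iff)
  with g' have ex: "GDERIV g x :> adjoint g' 1"
    unfolding gderiv_def by simp
  have "grad g x = adjoint g' 1"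
    unfolding grad_def
  proof (rule the_equality, rule ex)
    fix D assume "GDERIV g x :> D"
    with ex have "(\<lambda>u. u \<bullet> D) = (\<lambda>u. u \<bullet> adjoint g' 1)"
      unfolding gderiv_def by (rule has_derivative_unique[rotated])
    then show "D = adjoint g' 1"
      by (metis vector_eq_ldot)
  qed
  with ex show ?thesis by simp
qed

lemma grad_inner: "grad (\<lambda>y. c \<bullet> y) x = c"
proof -
  have *: "GDERIV (\<lambda>y. c \<bullet> y) x :> c"
    unfolding gderiv_def by (auto intro!: derivative_eq_intros simp: inner_commute)
  then have "GDERIV (\<lambda>y. c \<bullet> y) x :> grad (\<lambda>y. c \<bullet> y) x"
    by (intro GDERIV_grad) (auto simp: gderiv_def differentiable_def)
  with * have "(\<lambda>u. u \<bullet> grad (\<lambda>y. c \<bullet> y) x) = (\<lambda>u. u \<bullet> c)"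
    unfolding gderiv_def by (rule has_derivative_unique[rotated])
  then show ?thesis by (metis vector_eq_ldot)
qed

lemma has_derivative_grad:
  assumes "C2_on C g" "x \<in> C"
  shows "(grad g has_derivative (*v) (hessian g x)) (at x)"
  using assms unfolding C2_on_def hessian_def by (simp add: jacobian_works[symmetric])

lemma has_vector_derivative_grad_compose:
  assumes "C2_on C g" "x t \<in> C" "(x has_vector_derivative w) (at t within T)"
  shows "((\<lambda>s. grad g (x s)) has_vector_derivative hessian g (x t) *v w) (at t within T)"
  using vector_derivative_diff_chain_within[OF assms(3)
      has_derivative_at_withinI[OF has_derivative_grad[OF assms(1,2)]]]
  by (simp add: o_def)

text \<open>Strict monotonicity: on the segment from \<open>y\<close> to \<open>x\<close>, with
  direction \<open>u = x - y\<close>, the function \<open>grad g \<bullet> u\<close> has derivative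
  \<open>(hessian g *v u) \<bullet> u > 0\<close>. As \<open>u\<close> lies in the kernel,
  projecting the gradient does not change this inner product.\<close>

lemma proj_grad_injective:
  assumes "C2_on C g" "convex C" "\<And>x. x \<in> C \<Longrightarrow> sym_pos_def (hessian g x)"
    and "x \<in> C \<inter> aff A b" "y \<in> C \<inter> aff A b"
    and eq: "proj A 0 (grad g x) = proj A 0 (grad g y)"
  shows "x = y"
proof (rule ccontr)
  assume "x \<noteq> y"
  define u where "u = x - y"
  then have "u \<noteq> 0" using \<open>x \<noteq> y\<close> by simp
  have u: "A *v u = 0"
    using assms(4,5) by (simp add: u_def aff_def matrix_vector_mult_diff_distrib)
  have inC: "y + s *\<^sub>R u \<in> C" if "0 \<le> s" "s \<le> 1" for s
  proof -
    have "y + s *\<^sub>R u = (1 - s) *\<^sub>R y + s *\<^sub>R x" by (simp add: u_def algebra_simps)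
    then show ?thesis using assms(2,4,5) that by (auto intro!: convexD)
  qed
  have "grad g (y + 0 *\<^sub>R u) \<bullet> u < grad g (y + 1 *\<^sub>R u) \<bullet> u"
  proof (rule DERIV_pos_imp_increasing[where f = "\<lambda>s. grad g (y + s *\<^sub>R u) \<bullet> u"])
    fix s :: real assume s: "0 \<le> s" "s \<le> 1"
    have "((\<lambda>s. y + s *\<^sub>R u) has_vector_derivative u) (at s)"
      by (auto intro!: derivative_eq_intros)
    from has_vector_derivative_grad_compose[OF assms(1) inC[OF s] this]
    have "((\<lambda>s. grad g (y + s *\<^sub>R u) \<bullet> u) has_vector_derivative
      (hessian g (y + s *\<^sub>R u) *v u) \<bullet> u) (at s)"
      by (rule bounded_linear.has_vector_derivative[OF bounded_linear_inner_left])
    then have "DERIV (\<lambda>s. grad g (y + s *\<^sub>R u) \<bullet> u) s :> (hessian g (y + s *\<^sub>R u) *v u) \<bullet> u"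
      by (simp add: has_real_derivative_iff_has_vector_derivative)
    moreover have "0 < (hessian g (y + s *\<^sub>R u) *v u) \<bullet> u"
      by (intro sym_pos_def_inner_pos assms(3) inC s) (rule \<open>u \<noteq> 0\<close>)
    ultimately show "\<exists>d. DERIV (\<lambda>s. grad g (y + s *\<^sub>R u) \<bullet> u) s :> d \<and> 0 < d" by blast
  qed simp
  then have "grad g y \<bullet> u < grad g x \<bullet> u" by (simp add: u_def)
  moreover have "grad g z \<bullet> u = proj A 0 (grad g z) \<bullet> u" for z
    using proj_kernel_fixes[OF u] by (simp add: proj_kernel_inner)
  ultimately show False using eq by simp
qed

text \<open>By the chain rule the coordinate has velocity
  \<open>proj A 0 (hessian g (x t) *v - ?r)\<close>. The orthogonality property of
  \<open>riem_grad\<close> makes this \<open>- proj A 0 c\<close>, so \<open>?F\<close> has zero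
  derivative on the interval and is constant.\<close>

lemma HSD_solution_proj_grad:
  fixes A :: "real^'n^'m"
  assumes "rank A = CARD('m)" "C2_on C g" "\<And>x. x \<in> C \<Longrightarrow> sym_pos_def (hessian g x)"
    and "is_interval J" "0 \<in> J"
    and sol: "HSD_solution A b C (hessian g) (\<lambda>y. c \<bullet> y) J x0 x" and "t \<in> J"
  shows "proj A 0 (grad g (x t)) = proj A 0 (grad g x0) - t *\<^sub>R proj A 0 c"
proof -
  let ?F = "\<lambda>t. proj A 0 (grad g (x t)) + t *\<^sub>R proj A 0 c"
  have x0: "x 0 = x0" using sol by (simp add: HSD_solution_def)
  have "(?F has_derivative (\<lambda>h. 0)) (at t within J)" if "t \<in> J" for t
  proof -
    let ?r = "riem_grad A (hessian g) (\<lambda>y. c \<bullet> y) (x t)"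
    have xC: "x t \<in> C" and x': "(x has_vector_derivative - ?r) (at t within J)"
      using sol that by (auto simp: HSD_solution_def)
    have "((\<lambda>s. proj A 0 (grad g (x s))) has_vector_derivative
        proj A 0 (hessian g (x t) *v - ?r)) (at t within J)"
      by (intro bounded_linear.has_vector_derivative[OF bounded_linear_proj_kernel]
          has_vector_derivative_grad_compose[OF assms(2) xC x'])
    moreover have "proj A 0 (hessian g (x t) *v ?r - c) = 0"
      using riem_grad_orthogonal[where H = "hessian g" and x = "x t" and f = "\<lambda>y. c \<bullet> y",
          OF assms(1) assms(3)[OF xC]]
      by (intro proj_kernel_unique) (auto simp: grad_inner)
    then have "proj A 0 (hessian g (x t) *v - ?r) = - proj A 0 c"
      by (simp add: linear_diff[OF linear_proj_kernel] linear_neg[OF linear_proj_kernel]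
          linear_neg[OF matrix_vector_mul_linear])
    ultimately have "((\<lambda>s. proj A 0 (grad g (x s))) has_vector_derivative - proj A 0 c)
        (at t within J)" by simp
    moreover have "((\<lambda>s. s *\<^sub>R proj A 0 c) has_vector_derivative proj A 0 c) (at t within J)"
      by (auto intro!: derivative_eq_intros)
    ultimately have "(?F has_vector_derivative 0) (at t within J)"
      using has_vector_derivative_add by fastforce
    then show ?thesis by (simp add: has_vector_derivative_def)
  qed
  then obtain k where "\<forall>t\<in>J. ?F t = k"
    using has_derivative_zero_constant[of J ?F] is_interval_convex[OF assms(4)] by blast
  then have "?F t = ?F 0" using assms(5,7) by metis
  then show ?thesis by (simp add: x0 algebra_simps)
qed

lemma HSD_solution_unique:
  fixes A :: "real^'n^'m"
  assumes "rank A = CARD('m)" "C2_on C g" "\<And>x. x \<in> C \<Longrightarrow> sym_pos_def (hessian g x)"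
    and "convex C" "is_interval J" "0 \<in> J"
    and "HSD_solution A b C (hessian g) (\<lambda>y. c \<bullet> y) J x0 x"
    and "HSD_solution A b C (hessian g) (\<lambda>y. c \<bullet> y) J x0 y"
    and "t \<in> J"
  shows "x t = y t"
proof (rule proj_grad_injective[OF assms(2,4,3)])
  show "x t \<in> C \<inter> aff A b" "y t \<in> C \<inter> aff A b"
    using assms(7,8,9) unfolding HSD_solution_def by blast+
  show "proj A 0 (grad g (x t)) = proj A 0 (grad g (y t))"
    using HSD_solution_proj_grad[OF assms(1-3,5-6)] assms(7-9) by metis
qed

section \<open>Derivatives on intervals and at exceptional times\<close>

text \<open>The Lagrange equations are given on compact subintervals of \<open>J\<close>, whereas
  (H-SD) asks for derivatives within \<open>J\<close>. This supplies a compact subinterval with the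
  same derivative filter at \<open>t\<close>.\<close>

lemma at_within_interval_eq_Icc:
  fixes t :: real
  assumes "is_interval J" "t \<in> J"
  obtains a b where "a \<le> t" "t \<le> b" "{a..b} \<subseteq> J" "at t within J = at t within {a..b}"
proof -
  \<comment> \<open>A point of \<open>J\<close> to the left of \<open>t\<close> if there is one,
    otherwise \<open>t\<close> itself; \<open>b\<close> is the mirror image.\<close>
  obtain a where a: "a \<in> J" "a \<le> t" "a = t \<Longrightarrow> \<forall>s\<in>J. t \<le> s"
    using assms(2) by (metis less_imp_le not_less order_refl)
  obtain b where b: "b \<in> J" "t \<le> b" "b = t \<Longrightarrow> \<forall>s\<in>J. s \<le> t"
    using assms(2) by (metis less_imp_le not_less order_refl)
  \<comment> \<open>A side is cut off only when the chosen endpoint differs from \<open>t\<close>;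
    on any other side \<open>J\<close> has no points beyond \<open>t\<close>.\<close>
  define S where "S = (if a < t then {a<..} else UNIV) \<inter> (if t < b then {..<b} else UNIV)"
  show ?thesis
  proof
    show "a \<le> t" "t \<le> b" by fact+
    show sub: "{a..b} \<subseteq> J"
      using mem_is_interval_1_I[OF assms(1) a(1) b(1)] by auto
    show "at t within J = at t within {a..b}"
    proof (rule at_within_nhd)
      show "t \<in> S" "open S" by (auto simp: S_def)
      have "a \<le> s" "s \<le> b" if "s \<in> J" "s \<in> S" for s
      proof -
        show "a \<le> s" using a(2,3) that by (cases "a = t") (simp_all add: S_def)
        show "s \<le> b" using b(2,3) that by (cases "b = t") (simp_all add: S_def)
      qed
      with sub show "J \<inter> S - {t} = {a..b} \<inter> S - {t}" by auto
    qed
  qed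
qed

text \<open>The fundamental theorem of calculus tolerates finitely many exceptions, so
  \<open>x\<close> is a constant plus the integral of \<open>f\<close>. Continuity of
  \<open>f\<close> makes that integral differentiable at every point, exceptional points and
  endpoints included.\<close>

lemma has_vector_derivative_at_exceptional:
  fixes x :: "real \<Rightarrow> 'a::banach"
  assumes "finite S" "continuous_on {a..b} x" "continuous_on {a..b} f"
    and der: "\<And>t. t \<in> {a<..<b} - S \<Longrightarrow> (x has_vector_derivative f t) (at t)"
    and t: "t \<in> {a..b}"
  shows "(x has_vector_derivative f t) (at t within {a..b})"
proof -
  have "integral {a..u} f = x u - x a" if "u \<in> {a..b}" for u
  proof (rule integral_unique, rule fundamental_theorem_of_calculus_interior_strong[OF assms(1)])
    show "continuous_on {a..u} x"
      using assms(2) that by (auto elim: continuous_on_subset)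
  qed (use that der in auto)
  then have eq: "x u = x a + integral {a..u} f" if "u \<in> {a..b}" for u
    using that by simp
  have "((\<lambda>u. x a + integral {a..u} f) has_vector_derivative f t) (at t within {a..b})"
    using has_vector_derivative_add[OF has_vector_derivative_const
        integral_has_vector_derivative[OF assms(3) t]] by simp
  then show ?thesis
    by (rule has_vector_derivative_transform[OF t, rotated]) (rule eq)
qed


section \<open>Regular points and partial derivatives of the Lagrangian\<close>

lemma convex_edom:
  assumes "h \<in> Gamma0"
  shows "convex (edom h)"
proof (rule convexI)
  fix x y and u v :: real
  assume "x \<in> edom h" "y \<in> edom h" "0 \<le> u" "0 \<le> v" "u + v = 1"
  then have "h (u *\<^sub>R x + v *\<^sub>R y) \<le> ereal u * h x + ereal v * h y"
    and "h x \<noteq> -\<infinity>" "h y \<noteq> -\<infinity>" "h x \<noteq> \<infinity>" "h y \<noteq> \<infinity>"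
    using assms by (auto simp: Gamma0_def edom_def)
  then show "u *\<^sub>R x + v *\<^sub>R y \<in> edom h"
    by (cases "h x"; cases "h y") (auto simp: edom_def)
qed

lemma Gamma0_finite:
  assumes "h \<in> Gamma0" "x \<in> interior (edom h)"
  shows "h x = ereal (rpart h x)"
proof -
  have "x \<in> edom h" using assms(2) interior_subset by blast
  then show ?thesis
    using assms(1) by (cases "h x") (auto simp: Gamma0_def edom_def rpart_def)
qed

text \<open>Finiteness near \<open>v\<close> allows \<open>proj A b v\<close> to be moved slightly away from a point of
  \<open>interior (edom h)\<close> inside \<open>edom h\<close>, so it lies in an open segment from that point.\<close>

lemma regular_point_lagrangian_interior:
  assumes "h \<in> Gamma0" "b \<in> range ((*v) A)" "interior (edom h) \<inter> aff A b \<noteq> {}"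
    and "regular_point (lagrangian A b h c) q v"
  shows "proj A b v \<in> interior (edom h)"
proof -
  obtain a where a: "a \<in> interior (edom h)" "A *v a = b"
    using assms(3) by (auto simp: aff_def)
  define x where "x = proj A b v"
  have "A *v x = b" using proj_in_aff[OF assms(2), of v] unfolding x_def by (simp add: aff_def)
  then have ker: "A *v (a - x) = 0" by (simp add: matrix_vector_mult_diff_distrib a(2))
  \<comment> \<open>The velocity is pushed in the direction pointing away from the interior point
    \<open>a\<close>. This direction lies in the kernel, so the projection moves by exactly the same
    vector.\<close>
  have "((\<lambda>s. (q, v + s *\<^sub>R (x - a))) \<longlongrightarrow> (q, v + 0 *\<^sub>R (x - a))) (at_right 0)"
    by (intro tendsto_intros)
  then have "filterlim (\<lambda>s. (q, v + s *\<^sub>R (x - a))) (nhds (q, v)) (at_right 0)"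
    by simp
  with assms(4) have "\<forall>\<^sub>F s in at_right 0.
      \<bar>lagrangian A b h c (fst (q, v + s *\<^sub>R (x - a))) (snd (q, v + s *\<^sub>R (x - a)))\<bar> \<noteq> \<infinity>"
    unfolding regular_point_def by (elim conjE eventually_compose_filterlim)
  moreover have "\<forall>\<^sub>F s in at_right (0::real). 0 < s"
    by (rule eventually_at_right_less)
  ultimately have "\<forall>\<^sub>F s in at_right 0. 0 < s \<and> \<bar>lagrangian A b h c q (v + s *\<^sub>R (x - a))\<bar> \<noteq> \<infinity>"
    by eventually_elim simp
  then have "\<exists>s>0. \<bar>lagrangian A b h c q (v + s *\<^sub>R (x - a))\<bar> \<noteq> \<infinity>"
    by (rule eventually_happens'[rotated]) simp
  then obtain s where s: "0 < s" and fin: "\<bar>lagrangian A b h c q (v + s *\<^sub>R (x - a))\<bar> \<noteq> \<infinity>"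
    by (elim exE conjE)
  define y where "y = x + s *\<^sub>R (x - a)"
  have "A *v (s *\<^sub>R (x - a)) = 0"
    using ker by (simp add: matrix_vector_mult_scaleR matrix_vector_mult_diff_distrib)
  then have "proj A b (v + s *\<^sub>R (x - a)) = y"
    by (simp add: proj_add[OF assms(2)] proj_kernel_fixes y_def x_def)
  with fin have "y \<in> edom h"
    by (cases "h y") (auto simp: lagrangian_def edom_def)
  \<comment> \<open>This value solves \<open>e * (1 + s) = s\<close>, so that shrinking
    \<open>y\<close> towards \<open>a\<close> by the fraction \<open>e\<close> lands on
    \<open>x\<close>.\<close>
  define e where "e = s / (1 + s)"
  have "y - e *\<^sub>R (y - a) \<in> interior (edom h)"
    by (rule mem_interior_convex_shrink[OF convex_edom[OF assms(1)] a(1) \<open>y \<in> edom h\<close>])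
      (use s in \<open>auto simp: e_def\<close>)
  moreover have "y - e *\<^sub>R (y - a) = x"
  proof -
    have "y - a = (1 + s) *\<^sub>R (x - a)" by (simp add: y_def algebra_simps)
    then have "e *\<^sub>R (y - a) = s *\<^sub>R (x - a)" using s by (simp add: e_def)
    then show ?thesis by (simp add: y_def)
  qed
  ultimately show ?thesis by (simp add: x_def)
qed

lemma partial_q_lagrangian:
  assumes "h \<in> Gamma0" "proj A b v \<in> interior (edom h)"
  shows "partial_q (lagrangian A b h c) i q v = proj A 0 c $ i"
proof -
  have "(\<lambda>s. real_of_ereal (lagrangian A b h c (q + s *\<^sub>R axis i 1) v)) =
      (\<lambda>s. proj A 0 c \<bullet> q + s * (proj A 0 c $ i) - rpart h (proj A b v))"
    by (simp add: lagrangian_def Gamma0_finite[OF assms] inner_add_right inner_axis)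
  moreover have "DERIV (\<lambda>s. proj A 0 c \<bullet> q + s * (proj A 0 c $ i) - rpart h (proj A b v)) 0
      :> proj A 0 c $ i"
    by (auto intro!: derivative_eq_intros)
  ultimately show ?thesis
    unfolding partial_q_def by (metis DERIV_imp_deriv)
qed

text \<open>Varying the \<open>i\<close>-th velocity component moves the projected point along
  \<open>proj A 0 (axis i 1)\<close>. The chain rule gives the inner product of this vector with the
  gradient, and self-adjointness moves the projection onto the gradient.\<close>

lemma partial_v_lagrangian:
  assumes "h \<in> Gamma0" "b \<in> range ((*v) A)" "proj A b v \<in> interior (edom h)"
    and "rpart h differentiable (at (proj A b v))"
  shows "partial_v (lagrangian A b h c) i q v = - proj A 0 (grad (rpart h) (proj A b v)) $ i"
proof -
  define x where "x = proj A b v"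
  define e where "e = proj A 0 (axis i 1)"
  have line: "proj A b (v + s *\<^sub>R axis i 1) = x + s *\<^sub>R e" for s
    by (simp add: proj_add[OF assms(2)] linear_scale[OF linear_proj_kernel] x_def e_def)
  \<comment> \<open>Only for small \<open>s\<close> is the line known to stay in the interior, where
    \<open>h\<close> agrees with its finite part; the derivative at 0 needs no more.\<close>
  have "((\<lambda>s. x + s *\<^sub>R e) \<longlongrightarrow> x + 0 *\<^sub>R e) (nhds (0::real))"
    by (intro tendsto_intros filterlim_ident)
  then have "\<forall>\<^sub>F s in nhds 0. x + s *\<^sub>R e \<in> interior (edom h)"
    by (rule topological_tendstoD) (use assms(3) in \<open>auto simp: x_def\<close>)
  then have ev: "\<forall>\<^sub>F s in nhds 0. real_of_ereal (lagrangian A b h c q (v + s *\<^sub>R axis i 1)) =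
      proj A 0 c \<bullet> q - rpart h (x + s *\<^sub>R e)"
    by eventually_elim (simp add: lagrangian_def line Gamma0_finite[OF assms(1)])
  have "((\<lambda>s. x + s *\<^sub>R e) has_derivative (\<lambda>s. s *\<^sub>R e)) (at 0)"
    by (auto intro!: derivative_eq_intros)
  moreover have "(rpart h has_derivative (\<lambda>u. u \<bullet> grad (rpart h) x)) (at (x + 0 *\<^sub>R e))"
    using GDERIV_grad[OF assms(4)] by (simp add: gderiv_def x_def)
  ultimately have "((\<lambda>s. rpart h (x + s *\<^sub>R e)) has_derivative
      (\<lambda>s. (s *\<^sub>R e) \<bullet> grad (rpart h) x)) (at 0)"
    by (rule has_derivative_compose)
  then have "DERIV (\<lambda>s. rpart h (x + s *\<^sub>R e)) 0 :> e \<bullet> grad (rpart h) x"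
    by (simp add: has_field_derivative_def mult.commute[of _ "e \<bullet> _"] mult_commute_abs)
  then have "DERIV (\<lambda>s. proj A 0 c \<bullet> q - rpart h (x + s *\<^sub>R e)) 0 :> - (e \<bullet> grad (rpart h) x)"
    by (auto intro!: derivative_eq_intros)
  then have "DERIV (\<lambda>s. real_of_ereal (lagrangian A b h c q (v + s *\<^sub>R axis i 1))) 0
      :> - (e \<bullet> grad (rpart h) x)"
    using DERIV_cong_ev[OF refl ev refl] by simp
  then show ?thesis
    unfolding partial_v_def
    by (simp add: DERIV_imp_deriv e_def x_def proj_kernel_inner inner_axis')
qed

section \<open>From the Lagrange equations to (H-SD)\<close>

text \<open>The derivative of the Legendre coordinate is computed a second time by the chain rule.
  Comparison shows that \<open>hessian g (x t) *v (- w) - c\<close> is orthogonal to the kernel, so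
  \<open>- w\<close> meets the characterization of the gradient.\<close>

lemma velocity_eq_minus_riem_grad:
  fixes A :: "real^'n^'m"
  assumes "rank A = CARD('m)" "C2_on C g" "sym_pos_def (hessian g (x t))"
    and "x t \<in> C" "(x has_vector_derivative w) (at t)" "A *v w = 0"
    and der: "((\<lambda>s. proj A 0 (grad g (x s))) has_vector_derivative - proj A 0 c) (at t)"
  shows "w = - riem_grad A (hessian g) (\<lambda>y. c \<bullet> y) (x t)"
proof -
  have "((\<lambda>s. proj A 0 (grad g (x s))) has_vector_derivative proj A 0 (hessian g (x t) *v w)) (at t)"
    by (intro bounded_linear.has_vector_derivative[OF bounded_linear_proj_kernel]
        has_vector_derivative_grad_compose[OF assms(2,4,5)])
  with der have "proj A 0 (hessian g (x t) *v w) = - proj A 0 c"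
    by (rule vector_derivative_unique_at[rotated])
  then have *: "proj A 0 (hessian g (x t) *v (- w) - c) = 0"
    by (simp add: linear_diff[OF linear_proj_kernel] linear_neg[OF linear_proj_kernel]
        linear_neg[OF matrix_vector_mul_linear])
  have "- w = riem_grad A (hessian g) (\<lambda>y. c \<bullet> y) (x t)"
  proof (rule riem_grad_unique[where H = "hessian g" and x = "x t", OF assms(1,3)])
    show "A *v - w = 0" by (simp add: linear_neg[OF matrix_vector_mul_linear] assms(6))
    fix u assume "A *v u = 0"
    then show "(hessian g (x t) *v - w - grad (\<lambda>y. c \<bullet> y) (x t)) \<bullet> u = 0"
      using proj_kernel_orthogonal[of A u "hessian g (x t) *v (- w) - c"] *
      by (simp add: grad_inner)
  qed
  then show ?thesis by (metis minus_minus)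
qed


lemma has_vector_derivative_vec:
  fixes f :: "real \<Rightarrow> real^'n"
  assumes "\<And>i. ((\<lambda>s. f s $ i) has_real_derivative D $ i) (at t)"
  shows "(f has_vector_derivative D) (at t)"
proof -
  have "((\<lambda>s. f s \<bullet> e) has_derivative (\<lambda>h. (h *\<^sub>R D) \<bullet> e)) (at t)" if "e \<in> Basis" for e
  proof -
    from that obtain i where "e = axis i 1" by (auto simp: Basis_vec_def)
    with assms[of i] show ?thesis
      by (simp add: inner_axis has_field_derivative_def mult_commute_abs)
  qed
  then show ?thesis
    unfolding has_vector_derivative_def
    by (subst has_derivative_componentwise_within) blast
qed

lemma lagrange_solution_HSD:
  fixes A :: "real^'n^'m"
  assumes rank: "rank A = CARD('m)" and b: "b \<in> range ((*v) A)"
    and ne: "C \<inter> aff A b \<noteq> {}"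
    and h: "h \<in> Gamma0" and int: "interior (edom h) = C"
    and C2: "C2_on C (rpart h)"
    and pos: "\<And>x. x \<in> C \<Longrightarrow> sym_pos_def (hessian (rpart h) x)"
    and J: "is_interval J" "0 \<in> J"
    and sol: "lagrange_solution (lagrangian A b h c) C J q v"
  shows "HSD_solution A b C (hessian (rpart h)) (\<lambda>y. c \<bullet> y) J (proj A b (v 0)) (\<lambda>t. proj A b (v t))"
proof -
  let ?x = "\<lambda>t. proj A b (v t)"
  let ?R = "riem_grad A (hessian (rpart h)) (\<lambda>y. c \<bullet> y)"
  \<comment> \<open>Membership of \<open>v t\<close> in \<open>C\<close> does not place its
    projection there; finiteness of the Lagrangian near \<open>(q t, v t)\<close> does.\<close>
  have xC: "?x t \<in> C" if "t \<in> J" for t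
  proof -
    have "regular_point (lagrangian A b h c) (q t) (v t)"
      using sol that by (simp add: lagrange_solution_def)
    then show ?thesis
      using regular_point_lagrangian_interior[OF h b] ne by (simp add: int)
  qed
  have pq: "partial_q (lagrangian A b h c) i (q t) (v t) = proj A 0 c $ i" if "t \<in> J" for i t
    using partial_q_lagrangian[OF h] xC[OF that] by (simp add: int)
  have pv: "partial_v (lagrangian A b h c) i (q t) (v t) = - proj A 0 (grad (rpart h) (?x t)) $ i"
    if "t \<in> J" for i t
    using partial_v_lagrangian[OF h b] xC[OF that] C2 by (simp add: int C2_on_def)
  have "(?x has_vector_derivative - ?R (?x t)) (at t within J)" if tJ: "t \<in> J" for t
  proof -
    obtain a d where ad: "{a..d} \<subseteq> J" "t \<in> {a..d}"
      and at: "at t within J = at t within {a..d}"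
      using at_within_interval_eq_Icc[OF J(1) tJ] by (metis atLeastAtMost_iff)
    have "(\<lambda>t. (q t, v t)) piecewise_C1_differentiable_on {a..d}"
      using sol ad(1) by (simp add: lagrange_solution_def)
    then obtain S D where S: "finite S" and cont: "continuous_on {a..d} (\<lambda>t. (q t, v t))"
      and D: "\<forall>t\<in>{a..d} - S. ((\<lambda>t. (q t, v t)) has_vector_derivative D t) (at t)"
      unfolding piecewise_C1_differentiable_on_def C1_differentiable_on_def by (elim exE conjE)
    let ?lag = "\<lambda>t i.
      ((\<lambda>s. partial_v (lagrangian A b h c) i (q s) (v s)) has_real_derivative
        partial_q (lagrangian A b h c) i (q t) (v t)) (at t within J)"
    have "\<exists>S'. finite S' \<and> (\<forall>t\<in>{a..d} - S'. \<forall>i.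
        ?lag t i \<and> ((\<lambda>s. q s $ i) has_real_derivative v t $ i) (at t within J))"
      using sol ad(1) by (simp add: lagrange_solution_def)
    then obtain S' where S': "finite S'" and lag: "\<forall>t\<in>{a..d} - S'. \<forall>i.
        ?lag t i \<and> ((\<lambda>s. q s $ i) has_real_derivative v t $ i) (at t within J)"
      by (elim exE conjE)
    have "continuous_on {a..d} v"
      using continuous_on_snd[OF cont] by simp
    then have cx: "continuous_on {a..d} ?x"
      by (rule continuous_on_proj[OF b])
    have "continuous_on C ?R"
      using C2 by (intro continuous_on_riem_grad rank pos) (auto simp: C2_on_def grad_inner)
    then have cR: "continuous_on {a..d} (\<lambda>t. - ?R (?x t))"
      by (intro continuous_on_minus continuous_on_compose2[OF _ cx]) (use ad(1) xC in blast)+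
    \<comment> \<open>\<open>S\<close> collects the times where the path may fail to be
      differentiable, \<open>S'\<close> those where the equations may fail. Interior times make the
      derivatives two-sided.\<close>
    have "(?x has_vector_derivative - ?R (?x s)) (at s)" if "s \<in> {a<..<d} - (S \<union> S')" for s
    proof -
      have s: "s \<in> {a..d} - S" "s \<in> {a..d} - S'" "s \<in> {a<..<d}" "s \<in> J"
        using that ad(1) by auto
      have at_s: "at s within J = at s"
        using s(3) ad(1) by (intro at_within_open_subset[of _ "{a<..<d}"]) auto
      have "(v has_vector_derivative snd (D s)) (at s)"
        using bounded_linear.has_vector_derivative[OF bounded_linear_snd bspec[OF D s(1)]] by simp
      then have x': "(?x has_vector_derivative proj A 0 (snd (D s))) (at s)"
        by (rule has_vector_derivative_proj[OF b])
      \<comment> \<open>The momentum \<open>partial_v\<close> is minus this coordinate, so the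
        Lagrange equation is negated. The identification holds at times in \<open>J\<close>, hence
        the derivative within \<open>J\<close>.\<close>
      have "((\<lambda>s. proj A 0 (grad (rpart h) (?x s)) $ i) has_real_derivative (- proj A 0 c) $ i)
          (at s within J)" for i
      proof -
        have "((\<lambda>s. - partial_v (lagrangian A b h c) i (q s) (v s)) has_real_derivative
            (- proj A 0 c) $ i) (at s within J)"
          using DERIV_minus[OF conjunct1[OF lag[rule_format, OF s(2), of i]]] by (simp add: pq[OF s(4)])
        then show ?thesis
          unfolding has_field_derivative_def
          by (rule has_derivative_transform[OF s(4), rotated]) (simp add: pv)
      qed
      then have der: "((\<lambda>s. proj A 0 (grad (rpart h) (?x s))) has_vector_derivative - proj A 0 c) (at s)"
        unfolding at_s by (rule has_vector_derivative_vec)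
      show ?thesis
        using velocity_eq_minus_riem_grad[OF rank C2 pos[OF xC[OF s(4)]] xC[OF s(4)] x'
            proj_kernel_in_kernel der] x' by simp
    qed
    then show ?thesis
      unfolding at
      using has_vector_derivative_at_exceptional[where f = "\<lambda>t. - ?R (?x t)" and S = "S \<union> S'",
          OF finite_UnI[OF S S'] cx cR _ ad(2)] by blast
  qed
  moreover have xA: "?x t \<in> C \<inter> aff A b" if "t \<in> J" for t
    using xC[OF that] proj_in_aff[OF b, of "v t"] by (rule IntI)
  ultimately show ?thesis
    unfolding HSD_solution_def by (intro conjI ballI refl xA J(2))
qed

text \<open>Being "the solution" is expressed by two conjuncts: the projected velocity solves (H-SD)
  on \<open>J\<close>, and any solution on \<open>J\<close> with the same initial point agrees with
  it there. Admissibility of the initial point is part of \<open>HSD_solution\<close> and is thus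
  proved.\<close>

theorem theorem5p3:
  fixes A :: "real^'n^'m" and b :: "real^'m" and C :: "(real^'n) set"
    and h :: "real^'n \<Rightarrow> ereal" and c :: "real^'n"
    and J :: "real set" and q v :: "real \<Rightarrow> real^'n"
  assumes "CARD('m) < CARD('n)"
    and "rank A = CARD('m)"
    and "b \<in> range ((*v) A)"
    and "C \<noteq> {}" and "open C" and "convex C"
    and "C \<inter> aff A b \<noteq> {}"
    and "h \<in> Gamma0"
    and "legendre_type h" and "interior (edom h) = C"
    and "C2_on C (rpart h)"
    and "\<forall>x\<in>C. sym_pos_def (hessian (rpart h) x)"
    and "locally_lipschitz_on C (hessian (rpart h))"
    and "is_interval J" and "0 \<in> J"
    and "lagrange_solution (lagrangian A b h c) C J q v"
  shows "HSD_solution A b C (hessian (rpart h)) (\<lambda>y. c \<bullet> y) J (proj A b (v 0)) (\<lambda>t. proj A b (v t))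
    \<and> (\<forall>y. HSD_solution A b C (hessian (rpart h)) (\<lambda>y. c \<bullet> y) J (proj A b (v 0)) y
          \<longrightarrow> (\<forall>t\<in>J. y t = proj A b (v t)))"
proof (intro conjI allI impI ballI)
  have pos: "\<And>x. x \<in> C \<Longrightarrow> sym_pos_def (hessian (rpart h) x)" using assms(12) by blast
  show *: "HSD_solution A b C (hessian (rpart h)) (\<lambda>y. c \<bullet> y) J (proj A b (v 0))
      (\<lambda>t. proj A b (v t))"
    by (rule lagrange_solution_HSD[OF assms(2,3,7,8,10,11) pos assms(14,15,16)])
  fix y t
  assume y: "HSD_solution A b C (hessian (rpart h)) (\<lambda>y. c \<bullet> y) J (proj A b (v 0)) y"
    and t: "t \<in> J"
  show "y t = proj A b (v t)"
    using HSD_solution_unique[OF assms(2,11) pos assms(6,14,15) y * t] .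
qed

end
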